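(* Let $d$ be an integer with $d\ge 4$. (i) If $d$ is even, $n\ge 4d+1$ and $n\equiv 0\pmod 2$, then $\gamma^{SID}(C_n(1,d))=\frac n2$. (ii) If $n\ge 4d+1$ and $n\equiv 0\pmod 2$, then $\gamma^{SID}(C_n(1,d-1,d))=\frac n2$. (iii) If $d\equiv 1\pmod 3$, $n\ge 4d+5$ and $n\equiv 0\pmod 3$, then $\gamma^{SID}(C_n(1,d-1,d,d+1))=\frac n3$.
   Context: All graphs are simple and undirected. For a graph $G=(V,E)$ and $u\in V$, $N[u]=\{u\}\cup\{v: uv\in E\}$. A code is a nonempty $C\subseteq V$, and $I(C;u)=N[u]\cap C$. $C$ is self-identifying if $I(C;u)\setminus I(C;v)\neq\emptyset$ for all distinct $u,v\in V$. $\gamma^{SID}(G)$ is the minimum cardinality of a self-identifying code in a finite graph $G$. For positive integers $n$ and $d_1,\dots,d_k\le n/2$, the circulant graph $C_n(d_1,\dots,d_k)$ has vertex set $\mathbb{Z}_n$, and the open neighbourhood of $u$ is $\{u\pm d_1,\dots,u\pm d_k\}$ modulo $n$. *)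

theory Defs
  imports Complex_Main "HOL-Library.Extended_Nat"
begin

type_synonym 'a ugraph = "'a set \<times> 'a set set"

definition simple_graph :: "'a ugraph \<Rightarrow> bool" where
  "simple_graph G \<longleftrightarrow>
     (\<forall>e\<in>snd G. \<exists>u\<in>fst G. \<exists>v\<in>fst G. u \<noteq> v \<and> e = {u, v})"

definition open_nbhd :: "'a ugraph \<Rightarrow> 'a \<Rightarrow> 'a set" where
  "open_nbhd G u = {v \<in> fst G. {u, v} \<in> snd G}"

definition closed_nbhd :: "'a ugraph \<Rightarrow> 'a \<Rightarrow> 'a set" where
  "closed_nbhd G u = {u} \<union> open_nbhd G u"

definition is_code :: "'a ugraph \<Rightarrow> 'a set \<Rightarrow> bool" where
  "is_code G C \<longleftrightarrow> C \<noteq> {} \<and> C \<subseteq> fst G"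

definition I_set :: "'a ugraph \<Rightarrow> 'a set \<Rightarrow> 'a \<Rightarrow> 'a set" where
  "I_set G C u = closed_nbhd G u \<inter> C"

definition self_identifying :: "'a ugraph \<Rightarrow> 'a set \<Rightarrow> bool" where
  "self_identifying G C \<longleftrightarrow> is_code G C \<and>
     (\<forall>u\<in>fst G. \<forall>v\<in>fst G. u \<noteq> v \<longrightarrow> I_set G C u - I_set G C v \<noteq> {})"

text \<open>Meant for finite graphs. The value is \<open>\<infinity>\<close> exactly when the graph has no
  self-identifying code; otherwise the infimum is attained, so an equation
  \<open>gamma_SID G = enat k\<close> includes the existence of a code of size \<open>k\<close>.\<close>

definition gamma_SID :: "'a ugraph \<Rightarrow> enat" where
  "gamma_SID G = (INF C \<in> {C. self_identifying G C}. enat (card C))"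

text \<open>The residues modulo \<open>n\<close> are represented by \<open>0, \<dots>, n - 1\<close>. The distances in \<open>D\<close> are
  meant to be positive and at most \<open>n / 2\<close>.\<close>

definition circulant :: "nat \<Rightarrow> nat set \<Rightarrow> int ugraph" where
  "circulant n D =
     ({0..<int n},
      {{u, v} |u v. u \<in> {0..<int n} \<and>
         (\<exists>d\<in>D. v = (u + int d) mod int n \<or> v = (u - int d) mod int n)})"

lemma circulant_step_sym:
  fixes u v d m :: int
  assumes "0 \<le> u" "u < m"
  shows "v = (u + d) mod m \<Longrightarrow> u = (v - d) mod m"
    and "v = (u - d) mod m \<Longrightarrow> u = (v + d) mod m"
  using assms by (simp_all add: mod_simps)

lemma circulant_step_neq:
  fixes u d m :: int
  assumes "0 \<le> u" "u < m" "0 < d" "2 * d \<le> m"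
  shows "(u + d) mod m \<noteq> u" "(u - d) mod m \<noteq> u"
proof -
  have "\<not> m dvd d"
    using assms zdvd_not_zless by force
  moreover have "m dvd d" if "(u + d) mod m = u"
    using that assms by (metis add_diff_cancel_left' dvd_minus_mod)
  moreover have "m dvd d" if "(u - d) mod m = u"
  proof -
    have "m dvd (u - d) - u" using that by (metis dvd_minus_mod minus_diff_eq dvd_minus_iff)
    then show ?thesis by simp
  qed
  ultimately show "(u + d) mod m \<noteq> u" "(u - d) mod m \<noteq> u" by blast+
qed

lemma open_nbhd_circulant:
  assumes "u \<in> {0..<int n}"
  shows "open_nbhd (circulant n D) u =
           (\<Union>d\<in>D. {(u + int d) mod int n, (u - int d) mod int n})"
    (is "?L = ?R")
proof
  show "?R \<subseteq> ?L"
    using assms by (auto simp: open_nbhd_def circulant_def)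
  show "?L \<subseteq> ?R"
  proof
    fix v assume "v \<in> ?L"
    then have v: "v \<in> {0..<int n}" and
      "\<exists>a b. {u, v} = {a, b} \<and> a \<in> {0..<int n} \<and>
         (\<exists>d\<in>D. b = (a + int d) mod int n \<or> b = (a - int d) mod int n)"
      by (auto simp: open_nbhd_def circulant_def)
    then obtain a b d where ab: "{u, v} = {a, b}" "a \<in> {0..<int n}" and d: "d \<in> D"
      "b = (a + int d) mod int n \<or> b = (a - int d) mod int n"
      by blast
    have a: "0 \<le> a" "a < int n" using ab(2) by auto
    consider "u = a" "v = b" | "u = b" "v = a" using ab(1) by (auto simp: doubleton_eq_iff)
    then show "v \<in> ?R"
      using d circulant_step_sym[OF a] by cases blast+
  qed
qed

lemma simple_graph_circulant:
  assumes "\<forall>d\<in>D. 0 < d \<and> 2 * d \<le> n"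
  shows "simple_graph (circulant n D)"
  unfolding simple_graph_def
proof
  fix e assume "e \<in> snd (circulant n D)"
  then obtain u v d where e: "e = {u, v}" and u: "0 \<le> u" "u < int n" and d: "d \<in> D"
    and v: "v = (u + int d) mod int n \<or> v = (u - int d) mod int n"
    by (auto simp: circulant_def)
  have "0 < int d" "2 * int d \<le> int n" using assms d by force+
  then have "v \<noteq> u" using circulant_step_neq[OF u] v by metis
  moreover have "v \<in> {0..<int n}" using u v by auto
  ultimately show "\<exists>u\<in>fst (circulant n D). \<exists>v\<in>fst (circulant n D). u \<noteq> v \<and> e = {u, v}"
    using e u by (intro bexI[of _ u] bexI[of _ v]) (auto simp: circulant_def)
qed

end

theory Submission
  imports Defs
begin

text \<open>When all distances are less than \<open>n / 4\<close>, neighbourhoods do not wrap around, and a code is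
  self-identifying iff for no \<open>u\<close> the offsets of the code elements in \<open>N[u]\<close> fit into the offsets
  of a closed neighbourhood after a nonzero translation. For the multiples of 2 (respectively 3)
  this is a finite check.

  The three families are quotients of the square, triangular and king's lattice. For the lower
  bounds, (i) is triangle-free, so every open neighbourhood contains two code elements, and in
  (iii) \<open>N[u] - N[u + 1]\<close> has only three vertices; double counting finishes both. In (ii) the same
  counting only gives \<open>n / 3\<close>. There, if \<open>x\<close> and \<open>x + 1\<close> are both outside the code, then one of
  the two vertices \<open>y = x + d\<close> and \<open>y = x + 1 - d\<close> completing a triangle is in the code together
  with \<open>y - 1\<close> and \<open>y + 1\<close>. Counting these triples shows that at least as many pairs of
  consecutive vertices lie inside the code as outside it.\<close>

subsection \<open>Codes in circulant graphs as sets of offsets\<close>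

definition circulant_offsets :: "nat set \<Rightarrow> int set" where
  "circulant_offsets D = insert 0 (int ` D \<union> (\<lambda>d. - int d) ` D)"

definition code_offsets :: "nat \<Rightarrow> nat set \<Rightarrow> int set \<Rightarrow> int \<Rightarrow> int set" where
  "code_offsets n D C u = {s \<in> circulant_offsets D. (u + s) mod int n \<in> C}"

definition translation_rigid :: "'a::monoid_add set \<Rightarrow> 'a set \<Rightarrow> bool" where
  "translation_rigid S T \<longleftrightarrow> (\<forall>j. (\<forall>s\<in>S. s + j \<in> T) \<longrightarrow> j = 0)"

lemma translation_rigidI:
  assumes "\<And>j. (\<And>s. s \<in> S \<Longrightarrow> s + j \<in> T) \<Longrightarrow> j = 0"
  shows "translation_rigid S T"
  using assms by (auto simp: translation_rigid_def)

lemma translation_rigidE: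
  assumes "translation_rigid S T" "j \<noteq> 0"
  obtains s where "s \<in> S" "s + j \<notin> T"
  using assms by (auto simp: translation_rigid_def)

lemma fst_circulant [simp]: "fst (circulant n D) = {0..<int n}"
  by (simp add: circulant_def)

lemma zero_in_circulant_offsets [simp]: "0 \<in> circulant_offsets D"
  by (simp add: circulant_offsets_def)

lemma uminus_in_circulant_offsets: "s \<in> circulant_offsets D \<Longrightarrow> - s \<in> circulant_offsets D"
  by (auto simp: circulant_offsets_def)

lemma finite_circulant_offsets:
  assumes "\<forall>d\<in>D. 4 * d < n"
  shows "finite (circulant_offsets D)"
proof -
  have "finite D" by (rule finite_subset[of _ "{..n}"]) (use assms in auto)
  then show ?thesis by (simp add: circulant_offsets_def)
qed

lemma circulant_offset_bound:
  assumes "0 < n" "\<forall>d\<in>D. 4 * d < n" "s \<in> circulant_offsets D"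
  shows "4 * \<bar>s\<bar> < int n"
  using assms by (fastforce simp: circulant_offsets_def)

lemma closed_nbhd_circulant:
  assumes "u \<in> {0..<int n}"
  shows "closed_nbhd (circulant n D) u = (\<lambda>s. (u + s) mod int n) ` circulant_offsets D"
proof -
  have "u = (u + 0) mod int n" using assms by simp
  then show ?thesis
    using assms by (simp add: closed_nbhd_def open_nbhd_circulant circulant_offsets_def
        image_Un image_image) blast
qed

lemma I_set_circulant:
  assumes "u \<in> {0..<int n}"
  shows "I_set (circulant n D) C u = (\<lambda>s. (u + s) mod int n) ` code_offsets n D C u"
  using closed_nbhd_circulant[OF assms] by (auto simp: I_set_def code_offsets_def)

lemma code_offsets_mod [simp]: "code_offsets n D C (u mod int n) = code_offsets n D C u"
  by (simp add: code_offsets_def mod_simps)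

lemma dvd_abs_less_imp_eq_zero:
  fixes k m :: int
  assumes "m dvd k" "\<bar>k\<bar> < m"
  shows "k = 0"
  using assms dvd_imp_le_int[of k m] by linarith

lemma self_identifying_circulantD:
  assumes sid: "self_identifying (circulant n D) C" and n: "0 < n" and j: "\<not> int n dvd j"
  shows "\<exists>s\<in>code_offsets n D C u. s + j \<notin> circulant_offsets D"
proof -
  define a b where "a = u mod int n" and "b = (u - j) mod int n"
  have ab: "a \<in> {0..<int n}" "b \<in> {0..<int n}" using n by (auto simp: a_def b_def)
  have "a \<noteq> b"
    using j by (auto simp: a_def b_def mod_eq_dvd_iff)
  then obtain w where w: "w \<in> I_set (circulant n D) C a" "w \<notin> I_set (circulant n D) C b"
    using sid ab unfolding self_identifying_def fst_circulant by blast
  obtain s where s: "s \<in> code_offsets n D C u" "w = (u + s) mod int n"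
    using w(1) I_set_circulant[OF ab(1)] by (auto simp: a_def mod_simps)
  have "w \<in> C" using s by (simp add: code_offsets_def)
  then have "w \<notin> closed_nbhd (circulant n D) b" using w(2) by (simp add: I_set_def)
  moreover have "w = (b + (s + j)) mod int n"
    by (simp add: s(2) b_def mod_simps)
  ultimately show ?thesis
    using s(1) closed_nbhd_circulant[OF ab(2)] by blast
qed

lemma translation_rigid_code_offsets:
  assumes sid: "self_identifying (circulant n D) C" and n: "1 < n"
    and wide: "\<forall>d\<in>D. 4 * d < n"
  shows "translation_rigid (code_offsets n D C u) (circulant_offsets D)"
proof (rule translation_rigidI, rule ccontr)
  fix j :: int
  assume sub: "s + j \<in> circulant_offsets D" if "s \<in> code_offsets n D C u" for s
  assume "j \<noteq> 0"
  obtain s where s: "s \<in> code_offsets n D C u"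
    using self_identifying_circulantD[OF sid, of 1] n by auto
  then have "4 * \<bar>s\<bar> < int n" "4 * \<bar>s + j\<bar> < int n"
    using sub[OF s] n by (auto simp: code_offsets_def intro!: circulant_offset_bound[OF _ wide])
  then have "\<bar>j\<bar> < int n" using n by (simp add: abs_if split: if_splits)
  then have "\<not> int n dvd j" using \<open>j \<noteq> 0\<close> dvd_abs_less_imp_eq_zero by blast
  then show False
    using self_identifying_circulantD[OF sid, of j u] sub n by auto
qed

lemma I_set_circulant_subsetD:
  assumes uv: "u \<in> {0..<int n}" "v \<in> {0..<int n}"
    and sub: "I_set (circulant n D) C u \<subseteq> I_set (circulant n D) C v"
    and s: "s \<in> code_offsets n D C u"
  shows "\<exists>t\<in>circulant_offsets D. int n dvd (s + (u - v)) - t"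
proof -
  have "(u + s) mod int n \<in> closed_nbhd (circulant n D) v"
    using s sub I_set_circulant[OF uv(1)] by (auto simp: I_set_def)
  then obtain t where "t \<in> circulant_offsets D" "(u + s) mod int n = (v + t) mod int n"
    using closed_nbhd_circulant[OF uv(2)] by auto
  then show ?thesis by (auto simp: mod_eq_dvd_iff algebra_simps)
qed

lemma I_set_circulant_subset_imp_eq:
  assumes n: "0 < n" and wide: "\<forall>d\<in>D. 4 * d < n"
    and uv: "u \<in> {0..<int n}" "v \<in> {0..<int n}"
    and rigid: "translation_rigid (code_offsets n D C u) (circulant_offsets D)"
    and sub: "I_set (circulant n D) C u \<subseteq> I_set (circulant n D) C v"
  shows "u = v"
proof -
  let ?O = "circulant_offsets D"
  note bound = circulant_offset_bound[OF n wide]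
  obtain s where s: "s \<in> code_offsets n D C u"
    using rigid by (rule translation_rigidE[of _ _ 1]) auto
  obtain t where t: "t \<in> ?O" "int n dvd (s + (u - v)) - t"
    using I_set_circulant_subsetD[OF uv sub s] by blast
  have "s' + (t - s) \<in> ?O" if s': "s' \<in> code_offsets n D C u" for s'
  proof -
    obtain t' where t': "t' \<in> ?O" "int n dvd (s' + (u - v)) - t'"
      using I_set_circulant_subsetD[OF uv sub s'] by blast
    have "int n dvd (s' - t') - (s - t)"
      using dvd_diff[OF t'(2) t(2)] by (simp add: algebra_simps)
    moreover have "\<bar>(s' - t') - (s - t)\<bar> < int n"
      using bound[of s] bound[of t] bound[of s'] bound[of t'] s t(1) s' t'(1)
      by (simp add: code_offsets_def)
    ultimately have "(s' - t') - (s - t) = 0"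
      by (rule dvd_abs_less_imp_eq_zero)
    then have "s' + (t - s) = t'" by simp
    then show ?thesis using t'(1) by simp
  qed
  then have "t - s = 0"
    using rigid unfolding translation_rigid_def by blast
  then have "u mod int n = v mod int n"
    using t(2) by (simp add: mod_eq_dvd_iff)
  then show "u = v" using uv by simp
qed

lemma self_identifying_circulantI:
  assumes C: "C \<subseteq> {0..<int n}" and n: "0 < n" and wide: "\<forall>d\<in>D. 4 * d < n"
    and rigid: "\<And>u. translation_rigid (code_offsets n D C u) (circulant_offsets D)"
  shows "self_identifying (circulant n D) C"
proof -
  have "C \<noteq> {}"
    using rigid[of 0] by (rule translation_rigidE[of _ _ 1]) (auto simp: code_offsets_def)
  then show ?thesis
    using C I_set_circulant_subset_imp_eq[OF n wide _ _ rigid]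
    unfolding self_identifying_def is_code_def fst_circulant by blast
qed

subsection \<open>Multiples as a self-identifying code\<close>

lemma card_multiples_below:
  assumes "0 < m"
  shows "card {x \<in> {0..<int (m * q)}. int m dvd x} = q"
proof -
  have "{x \<in> {0..<int (m * q)}. int m dvd x} = (\<lambda>i. int m * i) ` {0..<int q}"
    using assms by (auto simp: dvd_def zero_le_mult_iff image_iff)
  moreover have "inj_on (\<lambda>i. int m * i) {0..<int q}"
    using assms by (auto simp: inj_on_def)
  ultimately show ?thesis by (simp add: card_image)
qed

lemma code_offsets_multiples:
  assumes "0 < n" "m dvd n"
  shows "code_offsets n D {x \<in> {0..<int n}. int m dvd x} u =
    {s \<in> circulant_offsets D. int m dvd u + s}"
  using assms by (auto simp: code_offsets_def dvd_mod_iff)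

lemma gamma_SID_eqI:
  assumes "self_identifying G C" "card C = k" "\<And>C'. self_identifying G C' \<Longrightarrow> k \<le> card C'"
  shows "gamma_SID G = enat k"
  unfolding gamma_SID_def
  by (rule antisym) (use assms in \<open>auto intro: INF_lower2 INF_greatest\<close>)

lemma gamma_SID_circulant_eqI:
  assumes offsets: "circulant_offsets D = T"
    and n: "0 < n" and wide: "\<forall>d\<in>D. 4 * d < n" and m: "0 < m" "m dvd n"
    and rigid: "\<And>u. translation_rigid {s \<in> T. int m dvd u + s} T"
    and lower: "\<And>C. self_identifying (circulant n D) C \<Longrightarrow> n \<le> m * card C"
  shows "gamma_SID (circulant n D) = enat (n div m)"
proof (rule gamma_SID_eqI)
  let ?M = "{x \<in> {0..<int n}. int m dvd x}"
  show "self_identifying (circulant n D) ?M"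
  proof (rule self_identifying_circulantI[OF _ n wide])
    show "translation_rigid (code_offsets n D ?M u) (circulant_offsets D)" for u
      unfolding code_offsets_multiples[OF n m(2)] offsets by (rule rigid)
  qed auto
  show "card ?M = n div m"
    using card_multiples_below[OF m(1), of "n div m"] m by simp
  show "n div m \<le> card C" if "self_identifying (circulant n D) C" for C
    using div_le_mono[OF lower[OF that], of m] m(1) by simp
qed

subsection \<open>Double counting\<close>

lemma sum_periodic_shift:
  fixes g :: "int \<Rightarrow> 'a::comm_monoid_add"
  assumes "0 < N" and per: "\<And>x. g (x mod N) = g x"
  shows "(\<Sum>x\<in>{0..<N}. g (x + a)) = (\<Sum>x\<in>{0..<N}. g x)"
  by (rule sum.reindex_bij_witness[of _ "\<lambda>y. (y - a) mod N" "\<lambda>x. (x + a) mod N"])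
    (use assms in \<open>auto simp: mod_simps\<close>)

lemma sum_translate_code:
  assumes "0 < n" "C \<subseteq> {0..<int n}"
  shows "(\<Sum>u\<in>{0..<int n}. of_bool ((u + a) mod int n \<in> C)) = card C"
proof -
  have "(\<Sum>u\<in>{0..<int n}. of_bool ((u + a) mod int n \<in> C)) =
      (\<Sum>u\<in>{0..<int n}. of_bool (u mod int n \<in> C))"
    by (rule sum_periodic_shift) (use assms in auto)
  also have "\<dots> = (\<Sum>u\<in>{0..<int n}. of_bool (u \<in> C))"
    by (rule sum.cong) auto
  also have "\<dots> = card C"
    using assms(2) by (simp add: Int_absorb1 Int_def[symmetric] sum.If_cases of_bool_def)
  finally show ?thesis .
qed

lemma card_code_ge_if_meets_translates:
  assumes n: "0 < n" and C: "C \<subseteq> {0..<int n}" and A: "finite A"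
    and hits: "\<And>u. r \<le> card {s \<in> A. (u + s) mod int n \<in> C}"
  shows "r * n \<le> card A * card C"
proof -
  have "r * n = (\<Sum>u\<in>{0..<int n}. r)"
    by simp
  also have "\<dots> \<le> (\<Sum>u\<in>{0..<int n}. card {s \<in> A. (u + s) mod int n \<in> C})"
    by (rule sum_mono) (rule hits)
  also have "\<dots> = (\<Sum>u\<in>{0..<int n}. \<Sum>s\<in>A. of_bool ((u + s) mod int n \<in> C))"
    using A by (simp add: Int_def)
  also have "\<dots> = (\<Sum>s\<in>A. \<Sum>u\<in>{0..<int n}. of_bool ((u + s) mod int n \<in> C))"
    by (rule sum.swap)
  also have "\<dots> = card A * card C"
    by (simp only: sum_translate_code[OF n C] sum_constant of_nat_id)
  finally show ?thesis .
qed

lemma self_identifying_circulant_subset: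
  "self_identifying (circulant n D) C \<Longrightarrow> C \<subseteq> {0..<int n}"
  by (simp add: self_identifying_def is_code_def)

lemma card_self_identifying_circulant_ge:
  assumes sid: "self_identifying (circulant n D) C" and n: "1 < n"
    and wide: "\<forall>d\<in>D. 4 * d < n" and j: "j \<noteq> 0"
  shows "n \<le> card {s \<in> circulant_offsets D. s + j \<notin> circulant_offsets D} * card C"
proof -
  let ?A = "{s \<in> circulant_offsets D. s + j \<notin> circulant_offsets D}"
  have "1 \<le> card {s \<in> ?A. (u + s) mod int n \<in> C}" for u
  proof -
    obtain s where "s \<in> code_offsets n D C u" "s + j \<notin> circulant_offsets D"
      using translation_rigid_code_offsets[OF sid n wide] j by (rule translation_rigidE)
    then have "{s \<in> ?A. (u + s) mod int n \<in> C} \<noteq> {}" by (auto simp: code_offsets_def)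
    then show ?thesis
      using finite_circulant_offsets[OF wide] by (simp add: Suc_le_eq card_gt_0_iff)
  qed
  then have "1 * n \<le> card ?A * card C"
    using n finite_circulant_offsets[OF wide] self_identifying_circulant_subset[OF sid]
    by (intro card_code_ge_if_meets_translates) auto
  then show ?thesis by simp
qed

lemma card_self_identifying_triangle_free_circulant_ge:
  assumes sid: "self_identifying (circulant n D) C" and n: "1 < n"
    and wide: "\<forall>d\<in>D. 4 * d < n"
    and nontrivial: "circulant_offsets D \<noteq> {0}"
    and triangle_free: "\<And>s t. \<lbrakk>s \<in> circulant_offsets D - {0}; t \<in> circulant_offsets D - {0}; s \<noteq> t\<rbrakk>
      \<Longrightarrow> s - t \<notin> circulant_offsets D"
  shows "2 * n \<le> card (circulant_offsets D - {0}) * card C"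
proof (rule card_code_ge_if_meets_translates)
  let ?A = "circulant_offsets D - {0}"
  fix u
  let ?B = "{s \<in> ?A. (u + s) mod int n \<in> C}"
  have other: "\<exists>s\<in>?B. s \<noteq> t" if t: "t \<in> ?A" for t
  proof -
    have "- t \<noteq> 0" using t by simp
    with translation_rigid_code_offsets[OF sid n wide]
    obtain s where s: "s \<in> code_offsets n D C u" "s + - t \<notin> circulant_offsets D"
      by (rule translation_rigidE)
    then have "s \<noteq> 0" "s \<noteq> t" using t uminus_in_circulant_offsets[of t D] by auto
    then show ?thesis using s(1) by (auto simp: code_offsets_def)
  qed
  obtain t where "t \<in> ?A" using nontrivial zero_in_circulant_offsets by blast
  then obtain s s' where "s \<in> ?B" "s' \<in> ?B" "s' \<noteq> s" using other by blast
  then have "card {s, s'} \<le> card ?B"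
    using finite_circulant_offsets[OF wide] by (intro card_mono) auto
  then show "2 \<le> card ?B" using \<open>s' \<noteq> s\<close> by simp
qed (use n finite_circulant_offsets[OF wide] self_identifying_circulant_subset[OF sid] in auto)

subsection \<open>Quotients of the triangular lattice\<close>

definition triangular_offsets :: "int \<Rightarrow> int set" where
  "triangular_offsets e = {0, 1, -1, e, - e, e - 1, 1 - e}"

definition outside_pair :: "(int \<Rightarrow> bool) \<Rightarrow> int \<Rightarrow> bool" where
  "outside_pair P x \<longleftrightarrow> \<not> P x \<and> \<not> P (x + 1)"

definition inside_pair :: "(int \<Rightarrow> bool) \<Rightarrow> int \<Rightarrow> bool" where
  "inside_pair P x \<longleftrightarrow> P x \<and> P (x + 1)"

text \<open>The conditions are symmetric under exchanging \<open>e\<close> and \<open>1 - e\<close>, the steps to the two common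
  neighbours of \<open>x\<close> and \<open>x + 1\<close>.\<close>

locale triangular_code =
  fixes e :: int and N :: int and P :: "int \<Rightarrow> bool"
  assumes e: "e \<le> -3 \<or> 4 \<le> e"
    and N: "0 < N"
    and periodic: "P (x mod N) = P x"
    and rigid: "translation_rigid {s \<in> triangular_offsets e. P (u + s)} (triangular_offsets e)"
begin

lemma reflect: "triangular_code (1 - e) N P"
proof
  have "triangular_offsets (1 - e) = triangular_offsets e"
    by (auto simp: triangular_offsets_def)
  then show "translation_rigid {s \<in> triangular_offsets (1 - e). P (u + s)}
      (triangular_offsets (1 - e))" for u using rigid by simp
qed (use e N periodic in auto)

lemma code_meets_offset_difference:
  assumes "j \<noteq> 0"
  shows "\<exists>s\<in>triangular_offsets e. s + j \<notin> triangular_offsets e \<and> P (u + s)"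
  using rigid[of u] assms by (auto elim: translation_rigidE)

lemma outside_pair_apex:
  assumes "outside_pair P x"
  shows "P (x + e) \<or> P (x + 1 - e)"
proof -
  have "P x \<or> P (x + e) \<or> P (x + 1 - e)"
    using code_meets_offset_difference[of "-1" "x + 1"] e
    by (auto simp: triangular_offsets_def algebra_simps)
  then show ?thesis using assms by (simp add: outside_pair_def)
qed

lemma outside_pair_beside_apex:
  assumes "outside_pair P x"
  shows "P (x + e - 1)" "P (x + e + 1)"
proof -
  have "P x \<or> P (x + 1) \<or> P (x + e - 1)"
    using code_meets_offset_difference[of "- e" "x + e"] e
    by (auto simp: triangular_offsets_def algebra_simps)
  moreover have "P x \<or> P (x + 1) \<or> P (x + e + 1)"
    using code_meets_offset_difference[of "1 - e" "x + e"] e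
    by (auto simp: triangular_offsets_def algebra_simps)
  ultimately show "P (x + e - 1)" "P (x + e + 1)" using assms by (auto simp: outside_pair_def)
qed

lemma outside_pairs_le_inside_pair:
  "of_bool (outside_pair P x \<and> P (x + e)) +
     of_bool (outside_pair P (x + 1) \<and> P (x + 1 + e) \<and> \<not> P (x + 1 + 1 - e))
   \<le> (of_bool (inside_pair P (x + e)) :: nat)"
proof -
  have "P (x + 1 + 1 - e)" if "outside_pair P x"
    using triangular_code.outside_pair_beside_apex(2)[OF reflect that] by (simp add: algebra_simps)
  moreover have "inside_pair P (x + e)" if "outside_pair P x" "P (x + e)"
    using outside_pair_beside_apex(2)[OF that(1)] that(2) by (simp add: inside_pair_def)
  moreover have "inside_pair P (x + e)" if "outside_pair P (x + 1)" "P (x + 1 + e)"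
    using outside_pair_beside_apex(1)[OF that(1)] that(2)
    by (simp add: inside_pair_def algebra_simps)
  ultimately show ?thesis by auto
qed

abbreviation period_count :: "(int \<Rightarrow> bool) \<Rightarrow> nat" where
  "period_count Q \<equiv> (\<Sum>x\<in>{0..<N}. of_bool (Q x))"

lemma period_count_shift:
  assumes "\<And>x. Q (x mod N) = Q x"
  shows "period_count (\<lambda>x. Q (x + a)) = period_count Q"
  using N assms by (intro sum_periodic_shift) auto

lemma periodic_shift: "P (x mod N + a) = P (x + a)"
  by (metis mod_add_left_eq periodic)

lemma periodic_pairs:
  "outside_pair P (x mod N) = outside_pair P x" "inside_pair P (x mod N) = inside_pair P x"
  by (simp_all add: outside_pair_def inside_pair_def periodic periodic_shift)

lemma count_outside_pairs_one_side:
  "period_count (\<lambda>x. outside_pair P x \<and> P (x + e)) +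
     period_count (\<lambda>x. outside_pair P x \<and> P (x + e) \<and> \<not> P (x + 1 - e))
   \<le> period_count (inside_pair P)"
proof -
  let ?only = "\<lambda>x. outside_pair P x \<and> P (x + e) \<and> \<not> P (x + 1 - e)"
  have "?only (x mod N) = ?only x" for x
    using periodic_shift[of x "1 - e"] by (simp add: periodic_pairs periodic_shift add_diff_eq)
  then have "period_count (\<lambda>x. ?only (x + 1)) = period_count ?only"
    by (rule period_count_shift)
  then have "period_count (\<lambda>x. outside_pair P x \<and> P (x + e)) + period_count ?only =
      period_count (\<lambda>x. outside_pair P x \<and> P (x + e)) + period_count (\<lambda>x. ?only (x + 1))"
    by (simp only:)
  also have "\<dots> \<le> period_count (\<lambda>x. inside_pair P (x + e))"
    unfolding sum.distrib[symmetric] by (rule sum_mono) (rule outside_pairs_le_inside_pair)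
  also have "\<dots> = period_count (inside_pair P)"
    by (rule period_count_shift) (rule periodic_pairs)
  finally show ?thesis .
qed

lemma count_outside_pairs_le_inside_pairs:
  "period_count (outside_pair P) \<le> period_count (inside_pair P)"
proof -
  interpret reflected: triangular_code "1 - e" N P by (rule reflect)
  have "2 * period_count (outside_pair P) =
      period_count (\<lambda>x. outside_pair P x \<and> P (x + e)) +
      period_count (\<lambda>x. outside_pair P x \<and> P (x + e) \<and> \<not> P (x + 1 - e)) +
      (period_count (\<lambda>x. outside_pair P x \<and> P (x + (1 - e))) +
       period_count (\<lambda>x. outside_pair P x \<and> P (x + (1 - e)) \<and> \<not> P (x + 1 - (1 - e))))"
    unfolding sum.distrib[symmetric] sum_distrib_left
    by (rule sum.cong) (use outside_pair_apex in \<open>auto simp: add_diff_eq\<close>)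
  then show ?thesis
    using count_outside_pairs_one_side reflected.count_outside_pairs_one_side by linarith
qed

lemma period_le_twice_count: "nat N \<le> 2 * period_count P"
proof -
  have "nat N + period_count (inside_pair P) =
      period_count (\<lambda>x. True) + period_count (inside_pair P)"
    by simp
  also have "\<dots> = period_count (outside_pair P) + (period_count P + period_count (\<lambda>x. P (x + 1)))"
    unfolding sum.distrib[symmetric]
    by (rule sum.cong) (auto simp: outside_pair_def inside_pair_def)
  also have "\<dots> \<le> period_count (inside_pair P) + 2 * period_count P"
    using count_outside_pairs_le_inside_pairs period_count_shift[of P 1] periodic by simp
  finally show ?thesis by simp
qed

end

subsection \<open>The three families\<close>

definition square_offsets :: "int \<Rightarrow> int set" where
  "square_offsets e = {0, 1, -1, e, - e}"

definition king_offsets :: "int \<Rightarrow> int set" where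
  "king_offsets e = {0, 1, -1, e - 1, 1 - e, e, - e, e + 1, - e - 1}"

lemma circulant_offsets_square: "circulant_offsets {1, d} = square_offsets (int d)"
  by (auto simp: circulant_offsets_def square_offsets_def)

lemma circulant_offsets_triangular:
  "1 \<le> d \<Longrightarrow> circulant_offsets {1, d - 1, d} = triangular_offsets (int d)"
  by (auto simp: circulant_offsets_def triangular_offsets_def)

lemma circulant_offsets_king:
  "1 \<le> d \<Longrightarrow> circulant_offsets {1, d - 1, d, d + 1} = king_offsets (int d)"
  by (auto simp: circulant_offsets_def king_offsets_def)

lemma translation_rigid_even_square_offsets:
  assumes e: "4 \<le> e" "even e"
  shows "translation_rigid {s \<in> square_offsets e. 2 dvd u + s} (square_offsets e)"
proof (rule translation_rigidI)
  fix j
  assume fits: "s + j \<in> square_offsets e" if "s \<in> {s \<in> square_offsets e. 2 dvd u + s}" for s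
  show "j = 0"
  proof (cases "even u")
    case True
    then show ?thesis
      using fits[of e] fits[of "- e"] e by (auto simp: square_offsets_def)
  next
    case False
    then show ?thesis
      using fits[of 1] fits[of "-1"] e by (auto simp: square_offsets_def)
  qed
qed

lemma translation_rigid_even_triangular_offsets:
  assumes e: "4 \<le> e"
  shows "translation_rigid {s \<in> triangular_offsets e. 2 dvd u + s} (triangular_offsets e)"
proof (rule translation_rigidI)
  fix j
  assume fits: "s + j \<in> triangular_offsets e"
    if "s \<in> {s \<in> triangular_offsets e. 2 dvd u + s}" for s
  show "j = 0"
  proof (cases "even (u + e)")
    case True
    then show ?thesis
      using fits[of e] fits[of "- e"] e by (auto simp: triangular_offsets_def)
  next
    case False
    then show ?thesis
      using fits[of "e - 1"] fits[of "1 - e"] e by (auto simp: triangular_offsets_def)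
  qed
qed

lemma translation_rigid_multiples_of_3_king_offsets:
  assumes e: "4 \<le> e" "e mod 3 = 1"
  shows "translation_rigid {s \<in> king_offsets e. 3 dvd u + s} (king_offsets e)"
proof (rule translation_rigidI)
  fix j
  assume fits: "s + j \<in> king_offsets e" if "s \<in> {s \<in> king_offsets e. 3 dvd u + s}" for s
  consider (zero) "u mod 3 = 0" | (one) "u mod 3 = 1" | (two) "u mod 3 = 2"
    by atomize_elim presburger
  then show "j = 0"
  proof cases
    case zero
    then have "3 dvd u + 0" "3 dvd u + (e - 1)" "3 dvd u + (1 - e)" using e by presburger+
    then have middle: "0 + j \<in> king_offsets e"
      and outer: "e - 1 + j \<in> king_offsets e" "1 - e + j \<in> king_offsets e"
      by (intro fits; simp add: king_offsets_def)+
    have "j \<in> {0, 2, -2}" using outer e(1) by (auto simp: king_offsets_def)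
    then show ?thesis using middle e(1) by (auto simp: king_offsets_def)
  next
    case one
    then have "3 dvd u + -1" "3 dvd u + - e" "3 dvd u + (e + 1)" using e by presburger+
    then have middle: "-1 + j \<in> king_offsets e"
      and outer: "- e + j \<in> king_offsets e" "e + 1 + j \<in> king_offsets e"
      by (intro fits; simp add: king_offsets_def)+
    have "j \<in> {0, -1}" using outer e(1) by (auto simp: king_offsets_def)
    then show ?thesis using middle e(1) by (auto simp: king_offsets_def)
  next
    case two
    then have "3 dvd u + 1" "3 dvd u + e" "3 dvd u + (- e - 1)" using e by presburger+
    then have middle: "1 + j \<in> king_offsets e"
      and outer: "e + j \<in> king_offsets e" "- e - 1 + j \<in> king_offsets e"
      by (intro fits; simp add: king_offsets_def)+
    have "j \<in> {0, 1}" using outer e(1) by (auto simp: king_offsets_def)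
    then show ?thesis using middle e(1) by (auto simp: king_offsets_def)
  qed
qed

lemma card_self_identifying_square_circulant_ge:
  assumes d: "4 \<le> d" and n: "4 * d + 1 \<le> n" and sid: "self_identifying (circulant n {1, d}) C"
  shows "n \<le> 2 * card C"
proof -
  let ?O = "square_offsets (int d)"
  have nonzero: "?O - {0} = {1, -1, int d, - int d}"
    using d by (auto simp: square_offsets_def)
  have "2 * n \<le> card (?O - {0}) * card C"
  proof (rule card_self_identifying_triangle_free_circulant_ge[OF sid,
        unfolded circulant_offsets_square])
    show "s - t \<notin> ?O" if "s \<in> ?O - {0}" "t \<in> ?O - {0}" "s \<noteq> t" for s t
      using that d by (auto simp: square_offsets_def)
  qed (use d n nonzero in auto)
  also have "\<dots> = 4 * card C"
    using d by (simp add: nonzero)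
  finally show ?thesis by simp
qed

lemma card_self_identifying_triangular_circulant_ge:
  assumes d: "4 \<le> d" and n: "4 * d + 1 \<le> n"
    and sid: "self_identifying (circulant n {1, d - 1, d}) C"
  shows "n \<le> 2 * card C"
proof -
  have offsets: "circulant_offsets {1, d - 1, d} = triangular_offsets (int d)"
    using d by (simp add: circulant_offsets_triangular del: One_nat_def)
  interpret triangular_code "int d" "int n" "\<lambda>x. x mod int n \<in> C"
  proof
    show "translation_rigid {s \<in> triangular_offsets (int d). (u + s) mod int n \<in> C}
        (triangular_offsets (int d))" for u
      using translation_rigid_code_offsets[OF sid, of u] d n
      unfolding code_offsets_def offsets by auto
  qed (use d n in auto)
  show ?thesis
    using period_le_twice_count n
      sum_translate_code[OF _ self_identifying_circulant_subset[OF sid], of 0] by simp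
qed

lemma card_self_identifying_king_circulant_ge:
  assumes d: "4 \<le> d" and n: "4 * d + 5 \<le> n"
    and sid: "self_identifying (circulant n {1, d - 1, d, d + 1}) C"
  shows "n \<le> 3 * card C"
proof -
  let ?O = "king_offsets (int d)"
  have "{s \<in> ?O. s + -1 \<notin> ?O} = {-1, int d - 1, - int d - 1}"
    using d by (auto simp: king_offsets_def)
  then have "card {s \<in> ?O. s + -1 \<notin> ?O} = 3" using d by simp
  moreover have "n \<le> card {s \<in> ?O. s + -1 \<notin> ?O} * card C"
    using card_self_identifying_circulant_ge[OF sid, of "-1"] d n
    by (subst (1 2) circulant_offsets_king[symmetric]) auto
  ultimately show ?thesis by simp
qed

lemma gamma_SID_square_circulant:
  assumes "4 \<le> d" "even d" "4 * d + 1 \<le> n" "even n"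
  shows "gamma_SID (circulant n {1, d}) = enat (n div 2)"
proof (rule gamma_SID_circulant_eqI[OF circulant_offsets_square])
  show "translation_rigid {s \<in> square_offsets (int d). int 2 dvd u + s}
      (square_offsets (int d))" for u
    using translation_rigid_even_square_offsets[of "int d" u] assms by simp
  show "n \<le> 2 * card C" if "self_identifying (circulant n {1, d}) C" for C
    using assms(1,3) that by (rule card_self_identifying_square_circulant_ge)
qed (use assms in auto)

lemma gamma_SID_triangular_circulant:
  assumes "4 \<le> d" "4 * d + 1 \<le> n" "even n"
  shows "gamma_SID (circulant n {1, d - 1, d}) = enat (n div 2)"
proof (rule gamma_SID_circulant_eqI[OF circulant_offsets_triangular])
  show "translation_rigid {s \<in> triangular_offsets (int d). int 2 dvd u + s}
      (triangular_offsets (int d))" for u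
    using translation_rigid_even_triangular_offsets[of "int d" u] assms by simp
  show "n \<le> 2 * card C" if "self_identifying (circulant n {1, d - 1, d}) C" for C
    using assms(1,2) that by (rule card_self_identifying_triangular_circulant_ge)
qed (use assms in auto)

lemma gamma_SID_king_circulant:
  assumes "4 \<le> d" "d mod 3 = 1" "4 * d + 5 \<le> n" "3 dvd n"
  shows "gamma_SID (circulant n {1, d - 1, d, d + 1}) = enat (n div 3)"
proof (rule gamma_SID_circulant_eqI[OF circulant_offsets_king])
  have "int d mod 3 = 1" using assms(2) by presburger
  then show "translation_rigid {s \<in> king_offsets (int d). int 3 dvd u + s}
      (king_offsets (int d))" for u
    using translation_rigid_multiples_of_3_king_offsets[of "int d" u] assms(1) by simp
  show "n \<le> 3 * card C" if "self_identifying (circulant n {1, d - 1, d, d + 1}) C" for C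
    using assms(1,3) that by (rule card_self_identifying_king_circulant_ge)
qed (use assms in auto)

theorem theorem7:
  fixes d :: nat
  assumes "d \<ge> 4"
  shows "(\<forall>n::nat. even d \<and> n \<ge> 4 * d + 1 \<and> n mod 2 = 0 \<longrightarrow>
            gamma_SID (circulant n {1, d}) = enat (n div 2)) \<and>
         (\<forall>n::nat. n \<ge> 4 * d + 1 \<and> n mod 2 = 0 \<longrightarrow>
            gamma_SID (circulant n {1, d - 1, d}) = enat (n div 2)) \<and>
         (\<forall>n::nat. d mod 3 = 1 \<and> n \<ge> 4 * d + 5 \<and> n mod 3 = 0 \<longrightarrow>
            gamma_SID (circulant n {1, d - 1, d, d + 1}) = enat (n div 3))"
  using gamma_SID_square_circulant[OF assms] gamma_SID_triangular_circulant[OF assms]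
    gamma_SID_king_circulant[OF assms]
  by (simp add: mod_eq_0_iff_dvd)

end
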